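(* Given an essentially $4$-edge connected cubic simple graph $G=(V,E)$ with $|V|>6$ and edges $au, uv, vc, vd\in E$, no two subsets $S,S'\subset V$ different than $\{u,v\}$ exist such that $au,vd\in\delta(S)$, $au,vc\in\delta(S')$, and $|\delta(S)|=|\delta(S')|=4$.
   Context: $G=(V,E)$ is a simple undirected graph with vertex set $V$ and edge set $E$; it is cubic if every vertex has degree $3$. For $A\subset V$, the cut $\delta(A)$ is the set of edges of $G$ with one endpoint in $A$ and the other in $V\setminus A$. A component of a graph is a subgraph in which any two vertices are connected to each other by paths and which is not connected to any other vertex of the graph. An edge cut $F$ of $G$ (a set of the form $F=\delta(A)$) is essential if the graph $(V,E\setminus F)$ has at least two components each containing more than one vertex. For a natural number $k$, $G$ is essentially $k$-edge connected if and only if $G$ does not have an essential edge cut $F$ with $|F|<k$.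
   Formalization: Besides S, S' ≠ {u,v}, the complements V∖S, V∖S' are also required to differ from {u,v} (otherwise S = S' = V∖{u,v} is always a counterexample); the four edges au, uv, vc, vd are taken pairwise distinct, and the graph finite. *)

theory Defs
  imports Main
begin

text \<open>A simple graph is a vertex set \<open>V\<close> with a set \<open>E\<close> of two-element subsets of \<open>V\<close>;
  graphs are finite.\<close>

definition simple_graph :: "'a set \<Rightarrow> 'a set set \<Rightarrow> bool" where
  "simple_graph V E \<longleftrightarrow> finite V \<and> (\<forall>e\<in>E. e \<subseteq> V \<and> card e = 2)"

definition degree :: "'a set set \<Rightarrow> 'a \<Rightarrow> nat" where
  "degree E x = card {e \<in> E. x \<in> e}"

definition cubic :: "'a set \<Rightarrow> 'a set set \<Rightarrow> bool" where
  "cubic V E \<longleftrightarrow> (\<forall>x\<in>V. degree E x = 3)"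

definition cut :: "'a set \<Rightarrow> 'a set set \<Rightarrow> 'a set \<Rightarrow> 'a set set" where
  "cut V E A = {e \<in> E. \<exists>x\<in>A. \<exists>y\<in>V - A. e = {x, y}}"

definition path_between :: "'a set \<Rightarrow> 'a set set \<Rightarrow> 'a \<Rightarrow> 'a list \<Rightarrow> 'a \<Rightarrow> bool" where
  "path_between V E x p y \<longleftrightarrow>
     p \<noteq> [] \<and> hd p = x \<and> last p = y \<and> distinct p \<and> set p \<subseteq> V \<and>
     successively (\<lambda>s t. {s, t} \<in> E) p"

definition connected_by_path :: "'a set \<Rightarrow> 'a set set \<Rightarrow> 'a \<Rightarrow> 'a \<Rightarrow> bool" where
  "connected_by_path V E x y \<longleftrightarrow> (\<exists>p. path_between V E x p y)"

text \<open>A component is an induced subgraph, so it is represented by its vertex set \<open>W\<close>;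
  its edges are those contained in \<open>W\<close>.\<close>

definition component :: "'a set \<Rightarrow> 'a set set \<Rightarrow> 'a set \<Rightarrow> bool" where
  "component V E W \<longleftrightarrow>
     W \<noteq> {} \<and> W \<subseteq> V \<and>
     (\<forall>x\<in>W. \<forall>y\<in>W. connected_by_path W {e \<in> E. e \<subseteq> W} x y) \<and>
     (\<forall>x\<in>W. \<forall>y\<in>V - W. \<not> connected_by_path V E x y)"

definition edge_cut :: "'a set \<Rightarrow> 'a set set \<Rightarrow> 'a set set \<Rightarrow> bool" where
  "edge_cut V E F \<longleftrightarrow> (\<exists>A\<subseteq>V. F = cut V E A)"

definition essential_edge_cut :: "'a set \<Rightarrow> 'a set set \<Rightarrow> 'a set set \<Rightarrow> bool" where
  "essential_edge_cut V E F \<longleftrightarrow>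
     edge_cut V E F \<and>
     (\<exists>W W'. W \<noteq> W' \<and> component V (E - F) W \<and> component V (E - F) W' \<and>
             card W > 1 \<and> card W' > 1)"

definition essentially_edge_connected :: "nat \<Rightarrow> 'a set \<Rightarrow> 'a set set \<Rightarrow> bool" where
  "essentially_edge_connected k V E \<longleftrightarrow>
     \<not> (\<exists>F. essential_edge_cut V E F \<and> card F < k)"

text \<open>A cut does not distinguish a vertex set from its complement, so a side of a cut
  is compared with \<open>T\<close> up to complementation in \<open>V\<close>. Literal inequality
  \<open>S \<noteq> {u, v}\<close> would not do in the theorem: the complement of \<open>{u, v}\<close>
  determines the same cut as \<open>{u, v}\<close>, consisting of the four edges leaving \<open>{u, v}\<close>.\<close>

definition differs_as_cut_side :: "'a set \<Rightarrow> 'a set \<Rightarrow> 'a set \<Rightarrow> bool" where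
  "differs_as_cut_side V S T \<longleftrightarrow> S \<noteq> T \<and> V - S \<noteq> T"

end

theory Submission
  imports Defs
begin

text \<open>In an essentially 4-edge connected cubic graph a cut of at most three edges has a side
  with at most one vertex, so in particular there is no triangle once \<open>card V > 4\<close>. Orient
  the cuts so that both \<open>S\<close> and \<open>S'\<close> contain \<open>u\<close>. Moving a vertex with two
  neighbours across a 4-edge cut to the other side leaves at most three cut edges; this forces
  \<open>S\<close> to contain \<open>u, v, c\<close> and \<open>S'\<close> to contain \<open>u, v, d\<close>. Because the edge
  \<open>au\<close> joins \<open>S \<inter> S'\<close> to the outside of \<open>S \<union> S'\<close>, the cuts of \<open>S - S'\<close> and
  \<open>S' - S\<close> have at most six edges together, so these sets are \<open>{c}\<close> and \<open>{d}\<close>. The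
  cut of \<open>S \<inter> S'\<close> has at least five edges by the same vertex move at \<open>v\<close>, so the cut of
  \<open>S \<union> S'\<close> has at most three, and the outside of \<open>S \<union> S'\<close> is \<open>{a}\<close>. Counting gives edges
  \<open>ac\<close> and \<open>ad\<close>, and the resulting \<open>K\<^sub>2\<^sub>,\<^sub>3\<close> on \<open>{a, v}\<close> and
  \<open>{u, c, d}\<close> is left by only three edges, so \<open>card V \<le> 6\<close>.\<close>

subsection \<open>Components\<close>

text \<open>Reachability as a reflexive transitive closure permits induction and concatenation; the
  paths of the definition have distinct vertices and do not simply concatenate.\<close>

definition adj_rel :: "'a set \<Rightarrow> 'a set set \<Rightarrow> ('a \<times> 'a) set" where
  "adj_rel V E = {(s, t). s \<in> V \<and> t \<in> V \<and> {s, t} \<in> E}"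

lemma connected_by_path_imp_rtrancl:
  assumes "connected_by_path V E x y"
  shows "(x, y) \<in> (adj_rel V E)\<^sup>*"
proof -
  have "(hd p, last p) \<in> (adj_rel V E)\<^sup>*"
    if "p \<noteq> []" "set p \<subseteq> V" "successively (\<lambda>s t. {s, t} \<in> E) p" for p
    using that
  proof (induction p rule: induct_list012)
    case (3 s t p)
    then have "(s, t) \<in> adj_rel V E" "(t, last (t # p)) \<in> (adj_rel V E)\<^sup>*"
      by (auto simp: adj_rel_def)
    then show ?case by (simp add: converse_rtrancl_into_rtrancl)
  qed auto
  then show ?thesis
    using assms by (auto simp: connected_by_path_def path_between_def)
qed

lemma rtrancl_imp_connected_by_path:
  assumes "(x, y) \<in> (adj_rel V E)\<^sup>*" and "x \<in> V"
  shows "connected_by_path V E x y"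
  using assms(1)
proof (induction rule: rtrancl_induct)
  case base
  have "path_between V E x [x] x" using assms(2) by (simp add: path_between_def)
  then show ?case by (auto simp: connected_by_path_def)
next
  case (step y z)
  then obtain p where p: "path_between V E x p y" by (auto simp: connected_by_path_def)
  have z: "z \<in> V" "{y, z} \<in> E" using step.hyps by (auto simp: adj_rel_def)
  show ?case
  proof (cases "z \<in> set p")
    case True
    \<comment> \<open>The path already visits \<open>z\<close>: truncating it at \<open>z\<close>
      keeps its vertices distinct.\<close>
    then obtain q r where "p = q @ z # r" by (meson split_list)
    then have "path_between V E x (q @ [z]) z"
      using p by (auto simp: path_between_def successively_append_iff hd_append split: if_splits)
    then show ?thesis by (auto simp: connected_by_path_def)
  next
    case False
    then have "path_between V E x (p @ [z]) z"
      using p z by (auto simp: path_between_def successively_append_iff)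
    then show ?thesis by (auto simp: connected_by_path_def)
  qed
qed

text \<open>Every vertex of a walk from \<open>x\<close> is itself reachable from \<open>x\<close>,
  so the walk uses only edges of the induced subgraph. By symmetry any two reachable vertices are
  joined through \<open>x\<close>.\<close>

lemma component_reachable_set:
  assumes "x \<in> V"
  shows "component V E ((adj_rel V E)\<^sup>* `` {x})"
proof -
  let ?R = "adj_rel V E"
  let ?W = "?R\<^sup>* `` {x}"
  let ?RW = "adj_rel ?W {e \<in> E. e \<subseteq> ?W}"
  have sub: "?W \<subseteq> V"
  proof
    fix y assume "y \<in> ?W"
    then have "(x, y) \<in> ?R\<^sup>*" by simp
    then show "y \<in> V" by (cases rule: rtranclE) (use assms in \<open>auto simp: adj_rel_def\<close>)
  qed
  have inside: "(x, y) \<in> ?RW\<^sup>*" if "(x, y) \<in> ?R\<^sup>*" for y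
    using that
  proof (induction rule: rtrancl_induct)
    case (step y z)
    then have "(x, z) \<in> ?R\<^sup>*" by (meson rtrancl.rtrancl_into_rtrancl)
    with step.hyps have "(y, z) \<in> ?RW" by (auto simp: adj_rel_def)
    with step.IH show ?case by (meson rtrancl.rtrancl_into_rtrancl)
  qed simp
  have "sym ?RW" by (auto simp: sym_def adj_rel_def insert_commute)
  then have sym: "sym (?RW\<^sup>*)" by (rule sym_rtrancl)
  have "(y, z) \<in> ?RW\<^sup>*" if "y \<in> ?W" "z \<in> ?W" for y z
  proof -
    have "(x, y) \<in> ?RW\<^sup>*" "(x, z) \<in> ?RW\<^sup>*" using that by (simp_all add: inside)
    then show ?thesis using symD[OF sym] by (blast intro: rtrancl_trans)
  qed
  then have conn: "\<forall>y\<in>?W. \<forall>z\<in>?W. connected_by_path ?W {e \<in> E. e \<subseteq> ?W} y z"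
    by (blast intro: rtrancl_imp_connected_by_path)
  have "\<forall>y\<in>?W. \<forall>z\<in>V - ?W. \<not> connected_by_path V E y z"
    by (auto dest!: connected_by_path_imp_rtrancl dest: rtrancl_trans)
  with sub conn show ?thesis unfolding component_def by blast
qed

text \<open>Once the cut is deleted no edge leaves \<open>A\<close>, so the component of
  \<open>x\<close> stays in \<open>A\<close>. The edge \<open>{x, y}\<close> survives, having both
  ends in \<open>A\<close>, and puts \<open>y\<close> into that component.\<close>

lemma component_within_cut_side:
  assumes "finite V" and "A \<subseteq> V" and "{x, y} \<in> E" and "x \<in> A" and "y \<in> A" and "x \<noteq> y"
  obtains W where "component V (E - cut V E A) W" and "card W > 1" and "W \<subseteq> A" and "W \<noteq> {}"
proof
  let ?R = "adj_rel V (E - cut V E A)"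
  let ?W = "?R\<^sup>* `` {x}"
  show "component V (E - cut V E A) ?W"
    using assms by (intro component_reachable_set) auto
  show sub: "?W \<subseteq> A"
  proof
    fix z assume "z \<in> ?W"
    then have "(x, z) \<in> ?R\<^sup>*" by simp
    then show "z \<in> A"
      by (induction rule: rtrancl_induct) (use assms in \<open>auto simp: adj_rel_def cut_def\<close>)
  qed
  have "(x, y) \<in> ?R"
    using assms by (auto simp: adj_rel_def cut_def doubleton_eq_iff)
  then have "{x, y} \<subseteq> ?W" by auto
  moreover have "finite ?W" using sub assms by (meson finite_subset)
  ultimately have "card {x, y} \<le> card ?W" by (meson card_mono)
  then show "card ?W > 1" using assms by simp
  show "?W \<noteq> {}" by auto
qed

subsection \<open>Counting edges between vertex sets\<close>

text \<open>Adjacent pairs are counted as ordered pairs, so \<open>edge_count E A A\<close> is twice the number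
  of edges inside \<open>A\<close>.\<close>

definition edge_count :: "'a set set \<Rightarrow> 'a set \<Rightarrow> 'a set \<Rightarrow> nat" where
  "edge_count E P Q = card {(x, y) \<in> P \<times> Q. {x, y} \<in> E}"

lemma edge_count_commute: "edge_count E P Q = edge_count E Q P"
proof -
  have "{(x, y) \<in> Q \<times> P. {x, y} \<in> E} = prod.swap ` {(x, y) \<in> P \<times> Q. {x, y} \<in> E}"
    by (force simp: insert_commute)
  then show ?thesis unfolding edge_count_def by (simp add: card_image)
qed

lemma edge_count_Un_left:
  assumes "finite P" "finite P'" "finite Q" "P \<inter> P' = {}"
  shows "edge_count E (P \<union> P') Q = edge_count E P Q + edge_count E P' Q"
proof -
  have "{(x, y) \<in> (P \<union> P') \<times> Q. {x, y} \<in> E} =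
      {(x, y) \<in> P \<times> Q. {x, y} \<in> E} \<union> {(x, y) \<in> P' \<times> Q. {x, y} \<in> E}" by auto
  moreover have "finite {(x, y) \<in> P \<times> Q. {x, y} \<in> E}" "finite {(x, y) \<in> P' \<times> Q. {x, y} \<in> E}"
    using assms by (auto intro: finite_subset[of _ "P \<times> Q"] finite_subset[of _ "P' \<times> Q"])
  ultimately show ?thesis
    unfolding edge_count_def using assms by (simp add: card_Un_disjoint disjoint_iff)
qed

lemma edge_count_Un_right:
  assumes "finite P" "finite Q" "finite Q'" "Q \<inter> Q' = {}"
  shows "edge_count E P (Q \<union> Q') = edge_count E P Q + edge_count E P Q'"
  using edge_count_Un_left[of Q Q' P E] assms by (simp add: edge_count_commute)

text \<open>Nonemptiness keeps the next two rules from looping on singletons in the simplifier.\<close>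

lemma edge_count_insert_left:
  assumes "finite P" "finite Q" "x \<notin> P" "P \<noteq> {}"
  shows "edge_count E (insert x P) Q = edge_count E {x} Q + edge_count E P Q"
  using edge_count_Un_left[of "{x}" P Q E] assms by simp

lemma edge_count_insert_right:
  assumes "finite P" "finite Q" "y \<notin> Q" "Q \<noteq> {}"
  shows "edge_count E P (insert y Q) = edge_count E P {y} + edge_count E P Q"
  using edge_count_Un_right[of P "{y}" Q E] assms by simp

lemma edge_count_singletons: "edge_count E {x} {y} = (if {x, y} \<in> E then 1 else 0)"
proof -
  have "{(x', y') \<in> {x} \<times> {y}. {x', y'} \<in> E} = (if {x, y} \<in> E then {(x, y)} else {})" by auto
  then show ?thesis by (simp add: edge_count_def)
qed

lemma edge_count_mono:
  assumes "finite P'" "finite Q'" "P \<subseteq> P'" "Q \<subseteq> Q'"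
  shows "edge_count E P Q \<le> edge_count E P' Q'"
  unfolding edge_count_def
  using assms by (intro card_mono) (auto intro: finite_subset[of _ "P' \<times> Q'"])

lemma edge_count_empty [simp]: "edge_count E P {} = 0" "edge_count E {} P = 0"
  by (simp_all add: edge_count_def)

section \<open>Cut sizes as edge counts, and uncrossing\<close>

text \<open>A cut edge has exactly one orientation from \<open>A\<close> to the outside.\<close>

lemma card_cut:
  assumes "A \<subseteq> V"
  shows "card (cut V E A) = edge_count E A (V - A)"
proof -
  have "bij_betw (\<lambda>(x, y). {x, y}) {(x, y) \<in> A \<times> (V - A). {x, y} \<in> E} (cut V E A)"
    using assms by (auto simp: bij_betw_def inj_on_def cut_def image_def doubleton_eq_iff)
  then show ?thesis unfolding edge_count_def by (rule bij_betw_same_card[symmetric])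
qed

lemma cut_complement:
  assumes "A \<subseteq> V"
  shows "cut V E (V - A) = cut V E A"
proof -
  have "V - (V - A) = A" using assms by auto
  then show ?thesis unfolding cut_def by (metis insert_commute)
qed

text \<open>Posimodularity and submodularity of the cut size with the exact defect. \<open>S\<close>
  and \<open>T\<close> split \<open>V\<close> into four blocks; edges between opposite blocks count
  twice on the right and in neither cut on the left, all others equally often on both sides.\<close>

lemma card_cut_uncross:
  assumes "finite V" "S \<subseteq> V" "T \<subseteq> V"
  shows "card (cut V E (S - T)) + card (cut V E (T - S)) +
      2 * edge_count E (S \<inter> T) (V - (S \<union> T)) = card (cut V E S) + card (cut V E T)"
    and "card (cut V E (S \<inter> T)) + card (cut V E (S \<union> T)) +
      2 * edge_count E (S - T) (T - S) = card (cut V E S) + card (cut V E T)"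
proof -
  let ?X = "S \<inter> T" and ?C = "S - T" and ?D = "T - S" and ?Y = "V - (S \<union> T)"
  note fin = finite_subset[OF assms(2,1)] finite_subset[OF assms(3,1)] assms(1)
  have S: "card (cut V E S) = edge_count E (?X \<union> ?C) (?D \<union> ?Y)"
    using assms by (auto simp: card_cut intro!: arg_cong2[of _ _ _ _ "edge_count E"])
  have T: "card (cut V E T) = edge_count E (?X \<union> ?D) (?C \<union> ?Y)"
    using assms by (auto simp: card_cut intro!: arg_cong2[of _ _ _ _ "edge_count E"])
  have C: "card (cut V E ?C) = edge_count E ?C ((?X \<union> ?D) \<union> ?Y)"
    using assms by (subst card_cut) (auto intro!: arg_cong2[of _ _ _ _ "edge_count E"])
  have D: "card (cut V E ?D) = edge_count E ?D ((?X \<union> ?C) \<union> ?Y)"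
    using assms by (subst card_cut) (auto intro!: arg_cong2[of _ _ _ _ "edge_count E"])
  have X: "card (cut V E ?X) = edge_count E ?X ((?C \<union> ?D) \<union> ?Y)"
    using assms by (subst card_cut) (auto intro!: arg_cong2[of _ _ _ _ "edge_count E"])
  have U: "card (cut V E (S \<union> T)) = edge_count E ((?X \<union> ?C) \<union> ?D) ?Y"
    using assms by (subst card_cut) (auto intro!: arg_cong2[of _ _ _ _ "edge_count E"])
  have L: "edge_count E (?X \<union> ?C) Q = edge_count E ?X Q + edge_count E ?C Q"
    "edge_count E (?X \<union> ?D) Q = edge_count E ?X Q + edge_count E ?D Q"
    "edge_count E ((?X \<union> ?C) \<union> ?D) Q = edge_count E (?X \<union> ?C) Q + edge_count E ?D Q"
    if "finite Q" for Q
    using fin that by (intro edge_count_Un_left; blast)+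
  have R: "edge_count E P (?D \<union> ?Y) = edge_count E P ?D + edge_count E P ?Y"
    "edge_count E P (?C \<union> ?Y) = edge_count E P ?C + edge_count E P ?Y"
    "edge_count E P ((?X \<union> ?D) \<union> ?Y) = edge_count E P (?X \<union> ?D) + edge_count E P ?Y"
    "edge_count E P ((?X \<union> ?C) \<union> ?Y) = edge_count E P (?X \<union> ?C) + edge_count E P ?Y"
    "edge_count E P ((?C \<union> ?D) \<union> ?Y) = edge_count E P (?C \<union> ?D) + edge_count E P ?Y"
    "edge_count E P (?X \<union> ?D) = edge_count E P ?X + edge_count E P ?D"
    "edge_count E P (?X \<union> ?C) = edge_count E P ?X + edge_count E P ?C"
    "edge_count E P (?C \<union> ?D) = edge_count E P ?C + edge_count E P ?D"
    if "finite P" for P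
    using fin that by (intro edge_count_Un_right; blast)+
  have fins: "finite ?X" "finite ?C" "finite ?D" "finite ?Y" "finite (?D \<union> ?Y)" "finite (?C \<union> ?Y)"
    using fin by auto
  \<comment> \<open>Each pair of blocks gets one fixed order, so that both sides become the same
    sum.\<close>
  note comm = edge_count_commute[of E ?C ?X] edge_count_commute[of E ?D ?X]
    edge_count_commute[of E ?D ?C]
  show "card (cut V E ?C) + card (cut V E ?D) + 2 * edge_count E ?X ?Y =
      card (cut V E S) + card (cut V E T)"
    unfolding S T C D by (simp only: L R fins comm mult_2 add_ac)
  show "card (cut V E ?X) + card (cut V E (S \<union> T)) + 2 * edge_count E ?C ?D =
      card (cut V E S) + card (cut V E T)"
    unfolding S T X U by (simp only: L R fins comm mult_2 add_ac)
qed

subsection \<open>Essentially 4-edge connected cubic graphs\<close>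

locale essentially_4_connected_cubic =
  fixes V :: "'a set" and E :: "'a set set"
  assumes simple: "simple_graph V E" and cubic: "cubic V E"
    and essential: "essentially_edge_connected 4 V E"
begin

lemma finite_V: "finite V"
  using simple by (simp add: simple_graph_def)

lemma edge_in_V:
  assumes "{x, y} \<in> E"
  shows "x \<in> V" and "y \<in> V"
  using simple assms by (auto simp: simple_graph_def)

lemma no_loop: "{x, x} \<notin> E"
  using simple by (force simp: simple_graph_def)

lemma edge_count_vertex:
  assumes "x \<in> V"
  shows "edge_count E {x} V = 3"
proof -
  have "bij_betw (\<lambda>(x, y). {x, y}) {(x', y) \<in> {x} \<times> V. {x', y} \<in> E} {e \<in> E. x \<in> e}"
    unfolding bij_betw_def
  proof
    show "inj_on (\<lambda>(x, y). {x, y}) {(x', y) \<in> {x} \<times> V. {x', y} \<in> E}"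
      by (auto simp: inj_on_def doubleton_eq_iff)
    have "e \<in> (\<lambda>(x, y). {x, y}) ` {(x', y) \<in> {x} \<times> V. {x', y} \<in> E}" if "e \<in> E" "x \<in> e" for e
    proof -
      have "card e = 2" using simple that by (simp add: simple_graph_def)
      then obtain y where y: "e = {x, y}" using \<open>x \<in> e\<close>
        by (auto simp: card_2_iff doubleton_eq_iff)
      then have "y \<in> V" using that edge_in_V by simp
      then show ?thesis using that y by blast
    qed
    then show "(\<lambda>(x, y). {x, y}) ` {(x', y) \<in> {x} \<times> V. {x', y} \<in> E} = {e \<in> E. x \<in> e}"
      by auto
  qed
  then have "edge_count E {x} V = degree E x"
    unfolding edge_count_def degree_def by (rule bij_betw_same_card)
  then show ?thesis using cubic assms by (simp add: cubic_def)
qed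

lemma edge_count_V:
  assumes "A \<subseteq> V"
  shows "edge_count E A V = 3 * card A"
proof -
  have "finite A" using assms finite_V by (rule finite_subset)
  then show ?thesis using assms
  proof (induction A)
    case (insert x A)
    then show ?case
      by (cases "A = {}") (simp_all add: edge_count_insert_left edge_count_vertex finite_V)
  qed simp
qed

text \<open>The degree sum over \<open>A\<close> counts cut edges once and inside edges
  twice.\<close>

lemma card_cut_plus_inside:
  assumes "A \<subseteq> V"
  shows "card (cut V E A) + edge_count E A A = 3 * card A"
proof -
  have "finite A" using assms finite_V by (rule finite_subset)
  then have "edge_count E A ((V - A) \<union> A) = edge_count E A (V - A) + edge_count E A A"
    using finite_V by (intro edge_count_Un_right) auto
  moreover have "(V - A) \<union> A = V" using assms by auto
  ultimately show ?thesis using assms by (simp add: card_cut edge_count_V)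
qed

section \<open>Cuts of at most three edges\<close>

text \<open>Without inside edges the cut has \<open>3 * card A\<close> edges. Contrapositively, a
  larger side of a small cut contains an edge.\<close>

lemma independent_side:
  assumes "A \<subseteq> V" and "card (cut V E A) \<le> 3" and "\<And>x y. x \<in> A \<Longrightarrow> y \<in> A \<Longrightarrow> {x, y} \<notin> E"
  shows "card A \<le> 1"
proof -
  have "{(x, y) \<in> A \<times> A. {x, y} \<in> E} = {}" using assms(3) by auto
  then have "edge_count E A A = 0" unfolding edge_count_def by (simp only: card.empty)
  then show ?thesis using card_cut_plus_inside[OF assms(1)] assms(2) by simp
qed

text \<open>If both sides had two vertices, each would contain an edge and hence a component with
  more than one vertex, making the cut essential.\<close>

lemma small_cut:
  assumes "A \<subseteq> V" and "card (cut V E A) \<le> 3"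
  shows "card A \<le> 1 \<or> card (V - A) \<le> 1"
proof (rule ccontr)
  assume big: "\<not> ?thesis"
  have "\<exists>x y. x \<in> A \<and> y \<in> A \<and> {x, y} \<in> E"
    using independent_side[OF assms] big by blast
  then obtain x y where "x \<in> A" "y \<in> A" "{x, y} \<in> E" by blast
  moreover from this have "x \<noteq> y" using no_loop by auto
  ultimately obtain W where W: "component V (E - cut V E A) W" "card W > 1" "W \<subseteq> A" "W \<noteq> {}"
    using component_within_cut_side[OF finite_V assms(1)] by metis
  have "\<exists>x y. x \<in> V - A \<and> y \<in> V - A \<and> {x, y} \<in> E"
    using independent_side[of "V - A"] assms big by (auto simp: cut_complement)
  then obtain x' y' where "x' \<in> V - A" "y' \<in> V - A" "{x', y'} \<in> E" by blast
  moreover from this have "x' \<noteq> y'" using no_loop by auto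
  ultimately obtain W' where W': "component V (E - cut V E (V - A)) W'" "card W' > 1" "W' \<subseteq> V - A"
    using component_within_cut_side[OF finite_V, of "V - A"] by (metis Diff_subset)
  have "W \<noteq> W'" using W W' by auto
  then have "essential_edge_cut V E (cut V E A)"
    using W W' assms unfolding essential_edge_cut_def edge_cut_def
    by (auto simp: cut_complement)
  then show False using essential assms unfolding essentially_edge_connected_def by force
qed

text \<open>Besides identifying the side, this excludes cuts of fewer than three edges around such a
  set: a single vertex has three edges and no loop.\<close>

lemma small_cut_singleton:
  assumes "A \<subseteq> V" and "x \<in> A" and "card (V - A) > 1" and "card (cut V E A) \<le> 3"
  shows "A = {x}" and "card (cut V E A) = 3"
proof -
  have "card A \<le> 1" "finite A"
    using small_cut[OF assms(1,4)] assms finite_V by (auto intro: finite_subset)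
  then show x: "A = {x}" using assms(2) by (auto simp: card_le_Suc0_iff_eq)
  show "card (cut V E A) = 3"
    using card_cut_plus_inside[OF assms(1)] edge_count_singletons[of E x x] no_loop[of x]
    unfolding x by simp
qed

text \<open>Of the nine edge ends at a triangle six lie inside, so only three edges leave it, while
  at least two vertices lie outside.\<close>

lemma triangle_free:
  assumes "card V > 4" and "{x, y} \<in> E" and "{y, z} \<in> E" and "{x, z} \<in> E"
  shows False
proof -
  let ?T = "{x, y, z}"
  have dist: "x \<noteq> y" "y \<noteq> z" "x \<noteq> z" using assms no_loop by auto
  have sub: "?T \<subseteq> V" using assms edge_in_V by auto
  have "{y, x} \<in> E" "{z, y} \<in> E" "{z, x} \<in> E" using assms by (simp_all add: insert_commute)
  then have "edge_count E ?T ?T = 6"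
    using assms dist no_loop
    by (simp add: edge_count_insert_left edge_count_insert_right edge_count_singletons)
  then have "card (cut V E ?T) \<le> 3" using card_cut_plus_inside[OF sub] dist by simp
  then have "card ?T \<le> 1 \<or> card (V - ?T) \<le> 1" by (rule small_cut[OF sub])
  moreover have "card (V - ?T) = card V - 3" using sub dist by (simp add: card_Diff_subset)
  ultimately show False using dist assms(1) by simp
qed

section \<open>Sides of four-edge cuts\<close>

text \<open>Moving \<open>x\<close> to the other side of the cut would leave at most three cut edges.\<close>

lemma two_neighbours_across:
  assumes "S \<subseteq> V" and "card (cut V E S) \<le> 4" and "x \<in> S"
    and "y \<notin> S" and "z \<notin> S" and "y \<noteq> z" and "{x, y} \<in> E" and "{x, z} \<in> E"
  shows "card S \<le> 2"
proof -
  let ?S = "S - {x}" and ?T = "V - S"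
  have fin: "finite ?S" "finite ?T" "finite S" "finite V"
    using assms finite_V by (auto intro: finite_subset)
  have V: "y \<in> V" "z \<in> V" "x \<in> V" using assms edge_in_V by auto
  have "edge_count E {x} {y, z} = 2"
    using assms by (simp add: edge_count_insert_right edge_count_singletons)
  moreover have "edge_count E {x} {y, z} \<le> edge_count E {x} ?T"
    using fin V assms by (intro edge_count_mono) auto
  ultimately have two: "edge_count E {x} ?T \<ge> 2" by simp
  have "insert x (?S \<union> ?T) = V" using assms by auto
  then have "3 = edge_count E {x} (insert x (?S \<union> ?T))" using edge_count_vertex[of x] V by simp
  also have "\<dots> = edge_count E {x} {x} + edge_count E {x} (?S \<union> ?T)"
    using fin assms V by (intro edge_count_insert_right) auto
  also have "\<dots> = edge_count E {x} ?S + edge_count E {x} ?T"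
    using fin no_loop[of x]
    by (subst edge_count_Un_right) (auto simp: edge_count_singletons)
  finally have deg: "3 = edge_count E {x} ?S + edge_count E {x} ?T" .
  have "V - ?S = insert x ?T" using assms by auto
  then have "card (cut V E ?S) = edge_count E ?S (insert x ?T)"
    using assms by (subst card_cut) auto
  also have "\<dots> = edge_count E ?S {x} + edge_count E ?S ?T"
    using fin assms V by (intro edge_count_insert_right) auto
  finally have new: "card (cut V E ?S) = edge_count E {x} ?S + edge_count E ?S ?T"
    by (simp add: edge_count_commute)
  have "{x} \<union> ?S = S" using assms by auto
  then have "card (cut V E S) = edge_count E ({x} \<union> ?S) ?T"
    using assms by (simp add: card_cut)
  also have "\<dots> = edge_count E {x} ?T + edge_count E ?S ?T"
    using fin by (intro edge_count_Un_left) auto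
  \<comment> \<open>The move removes at least two cut edges at \<open>x\<close> and, as
    \<open>x\<close> has degree 3, creates at most one: 4 - 2 + 1 = 3.\<close>
  finally have "card (cut V E ?S) \<le> 3" using two deg new assms(2) by linarith
  then have "card ?S \<le> 1 \<or> card (V - ?S) \<le> 1" using assms by (intro small_cut) auto
  \<comment> \<open>\<open>y\<close> and \<open>z\<close> make the far side too large, so
    \<open>S - {x}\<close> is the side with at most one vertex.\<close>
  moreover have "card {y, z} \<le> card (V - ?S)" using V fin assms by (intro card_mono) auto
  moreover have "card {y, z} = 2" "card ?S = card S - 1" using assms by simp_all
  ultimately show ?thesis by linarith
qed

lemma cut_side_contains:
  assumes "card V > 4" and "{a, u} \<in> E" and "{u, v} \<in> E" and "{v, c} \<in> E" and "{v, d} \<in> E"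
    and "a \<noteq> v" and "c \<noteq> d" and "u \<noteq> d"
    and "S \<subseteq> V" and "S \<noteq> {u, v}" and "card (cut V E S) = 4"
    and "u \<in> S" and "a \<notin> S" and "v \<in> S \<longleftrightarrow> d \<notin> S"
  shows "v \<in> S" and "d \<notin> S" and "c \<in> S"
proof -
  have fin: "finite S" using assms finite_V by (meson finite_subset)
  have uv: "u \<noteq> v" using assms no_loop by auto
  show v: "v \<in> S"
  proof (rule ccontr)
    assume v: "v \<notin> S"
    then have d: "d \<in> S" using assms by simp
    \<comment> \<open>\<open>u\<close> has the two neighbours \<open>a\<close> and \<open>v\<close>
      outside \<open>S\<close>.\<close>
    have "card S \<le> 2"
      using assms v by (intro two_neighbours_across[of S u a v]) (auto simp: insert_commute)
    then have S: "S = {u, d}" using d assms fin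
      by (metis card_2_iff card_seteq empty_subsetI insert_subset)
    \<comment> \<open>3 * 2 - 4 = 2 ordered pairs remain inside, that is one edge, which closes the
      triangle \<open>u\<close>, \<open>v\<close>, \<open>d\<close>.\<close>
    then have "edge_count E {u, d} {u, d} = 2"
      using card_cut_plus_inside[of S] assms by simp
    then have "{u, d} \<in> E"
      using assms no_loop
      by (auto simp: edge_count_insert_left edge_count_insert_right edge_count_singletons
          insert_commute split: if_splits)
    then show False using triangle_free[of u v d] assms by blast
  qed
  then show d: "d \<notin> S" using assms by simp
  show "c \<in> S"
  proof (rule ccontr)
    assume "c \<notin> S"
    \<comment> \<open>Now \<open>v\<close> has the two neighbours \<open>c\<close> and
      \<open>d\<close> outside \<open>S\<close>.\<close>
    then have "card S \<le> 2"
      using assms v d by (intro two_neighbours_across[of S v c d]) auto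
    then have "S = {u, v}" using v assms fin uv
      by (metis card_2_iff card_seteq empty_subsetI insert_subset)
    then show False using assms by simp
  qed
qed

section \<open>Contradiction from two four-edge cuts\<close>

lemma no_two_cuts:
  assumes "card V > 6" and "{a, u} \<in> E" and "{u, v} \<in> E" and "{v, c} \<in> E" and "{v, d} \<in> E"
    and "a \<noteq> v" and "c \<noteq> d" and "u \<noteq> c" and "u \<noteq> d"
    and S: "S \<subseteq> V" "S \<noteq> {u, v}" "card (cut V E S) = 4" "u \<in> S" "a \<notin> S" "v \<in> S \<longleftrightarrow> d \<notin> S"
    and T: "T \<subseteq> V" "T \<noteq> {u, v}" "card (cut V E T) = 4" "u \<in> T" "a \<notin> T" "v \<in> T \<longleftrightarrow> c \<notin> T"
  shows False
proof -
  let ?X = "S \<inter> T" and ?Y = "V - (S \<union> T)"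
  have big: "card V > 4" using assms(1) by simp
  have inS: "v \<in> S" "d \<notin> S" "c \<in> S"
    using cut_side_contains[of a u v c d S] assms big by auto
  have inT: "v \<in> T" "c \<notin> T" "d \<in> T"
    using cut_side_contains[of a u v d c T] assms big by auto
  have V: "a \<in> V" "u \<in> V" "v \<in> V" "c \<in> V" "d \<in> V"
    using assms(2-5) edge_in_V by auto
  have fin: "finite S" "finite T" "finite V"
    using S T finite_V by (auto intro: finite_subset)
  have dist: "distinct [a, u, v, c, d]"
    using assms(2-9) inS inT no_loop S T by auto
  have sym: "{u, a} \<in> E" "{v, u} \<in> E" "{c, v} \<in> E" "{d, v} \<in> E"
    using assms(2-5) by (simp_all add: insert_commute)
  have nouc: "{u, c} \<notin> E" using triangle_free[of u v c] assms(3,4) big by blast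

  have "edge_count E {u} {a} \<le> edge_count E ?X ?Y"
    using S T V fin by (intro edge_count_mono) auto
  then have XY: "edge_count E ?X ?Y \<ge> 1" using sym by (simp add: edge_count_singletons)
  have six: "card (cut V E (S - T)) + card (cut V E (T - S)) + 2 * edge_count E ?X ?Y = 8"
    using card_cut_uncross(1)[OF finite_V S(1) T(1), of E] S T by simp
  \<comment> \<open>With \<open>u\<close> and \<open>v\<close> outside \<open>A\<close>, the
    complement cannot be the small side.\<close>
  have large: "card (V - A) > 1" if "A \<subseteq> V" "u \<notin> A" "v \<notin> A" for A
  proof -
    have "card {u, v} \<le> card (V - A)" using that V fin by (intro card_mono) auto
    then show ?thesis using dist by simp
  qed
  have ge3: "card (cut V E A) \<ge> 3" if "A \<subseteq> V" "x \<in> A" "u \<notin> A" "v \<notin> A" for A x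
    using small_cut_singleton(2)[of A x] that large[of A] by linarith
  have "card (cut V E (S - T)) \<ge> 3" "card (cut V E (T - S)) \<ge> 3"
    using ge3[of "S - T" c] ge3[of "T - S" d] S T inS inT by auto
  \<comment> \<open>The bounds 3 + 3 + 2 * 1 already exhaust the total of 8, so all are
    equalities.\<close>
  then have three: "card (cut V E (S - T)) \<le> 3" "card (cut V E (T - S)) \<le> 3"
    and XY1: "edge_count E ?X ?Y = 1"
    using six XY by linarith+
  have c: "S - T = {c}"
  proof -
    have "c \<in> S - T" "S - T \<subseteq> V" "card (V - (S - T)) > 1"
      using S T inS inT large[of "S - T"] by auto
    then show ?thesis using small_cut_singleton(1) three(1) by blast
  qed
  have d: "T - S = {d}"
  proof -
    have "d \<in> T - S" "T - S \<subseteq> V" "card (V - (T - S)) > 1"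
      using S T inS inT large[of "T - S"] by auto
    then show ?thesis using small_cut_singleton(1) three(2) by blast
  qed

  have X5: "card (cut V E ?X) \<ge> 5"
  proof (rule ccontr)
    assume "\<not> ?thesis"
    then have "card ?X \<le> 2"
      using assms inS inT by (intro two_neighbours_across[of ?X v c d]) auto
    moreover have "{u, v} \<subseteq> ?X" using S T inS inT by auto
    ultimately have "?X = {u, v}" using fin dist card_seteq[of ?X "{u, v}"] by simp
    then have Seq: "S = {u, v, c}" using c by blast
    have "{c, u} \<notin> E" using nouc by (simp add: insert_commute)
    \<comment> \<open>Only the edges \<open>{u, v}\<close> and \<open>{v, c}\<close> lie inside
      \<open>S\<close>, giving four ordered pairs; its cut would have 9 - 4 = 5 edges instead of
      4.\<close>
    with Seq have "edge_count E S S = 4"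
      using dist assms(2-5) sym nouc no_loop
      by (simp add: edge_count_insert_left edge_count_insert_right edge_count_singletons)
    then show False using card_cut_plus_inside[OF S(1)] S(3) Seq dist by simp
  qed
  \<comment> \<open>The two cuts of \<open>S \<inter> T\<close> and \<open>S \<union> T\<close>
    total at most 8, and the former takes at least 5.\<close>
  have "card (cut V E (S \<union> T)) \<le> 3"
    using card_cut_uncross(2)[OF finite_V S(1) T(1), of E] S(3) T(3) X5 by linarith
  then have "card (cut V E ?Y) \<le> 3" using S T by (simp add: cut_complement)
  then have a: "?Y = {a}"
  proof -
    have "a \<in> ?Y" "card (V - ?Y) > 1" using S T V inS large[of ?Y] by auto
    then show ?thesis using small_cut_singleton(1)[of ?Y] \<open>card (cut V E ?Y) \<le> 3\<close> by blast
  qed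
  have Veq: "V = ?X \<union> {a, c, d}" using a c d S T V by blast
  \<comment> \<open>As \<open>?Y = {a}\<close>, the single edge between \<open>?X\<close> and
    \<open>?Y\<close> is the only one from \<open>a\<close> to \<open>?X\<close>. The other two
    edges at \<open>a\<close> must go to \<open>c\<close> and \<open>d\<close>.\<close>
  have "3 = edge_count E {a} (?X \<union> {a, c, d})" using edge_count_vertex[OF V(1)] Veq by simp
  also have "\<dots> = edge_count E {a} ?X + edge_count E {a} {a, c, d}"
    using fin S T inS inT by (intro edge_count_Un_right) auto
  also have "edge_count E {a} ?X = 1"
    using XY1 a by (simp add: edge_count_commute)
  finally have "edge_count E {a} {a, c, d} = 2" by simp
  then have ac: "{a, c} \<in> E" and ad: "{a, d} \<in> E"
    using dist no_loop
    by (auto simp: edge_count_insert_right edge_count_singletons split: if_splits)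

  \<comment> \<open>Both \<open>a\<close> and \<open>v\<close> are adjacent to all of
    \<open>u\<close>, \<open>c\<close>, \<open>d\<close>: at least 12 of the 15 edge ends at
    \<open>?K\<close> lie inside, so at most three edges leave it.\<close>
  let ?K = "{a, v, u, c, d}"
  have KV: "?K \<subseteq> V" using V by simp
  have cardK: "card ?K = 5" using dist by auto
  have "edge_count E ?K ?K \<ge> edge_count E {a, v} {u, c, d} + edge_count E {u, c, d} {a, v}"
  proof -
    have "edge_count E ({a, v} \<union> {u, c, d}) ?K = edge_count E {a, v} ?K + edge_count E {u, c, d} ?K"
      using dist by (intro edge_count_Un_left) auto
    moreover have "{a, v} \<union> {u, c, d} = ?K" by auto
    ultimately have "edge_count E ?K ?K = edge_count E {a, v} ?K + edge_count E {u, c, d} ?K"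
      by simp
    moreover have "edge_count E {a, v} {u, c, d} \<le> edge_count E {a, v} ?K"
      "edge_count E {u, c, d} {a, v} \<le> edge_count E {u, c, d} ?K"
      by (intro edge_count_mono; auto)+
    ultimately show ?thesis by simp
  qed
  moreover have "edge_count E {a, v} {u, c, d} = 6"
    using dist assms(2-5) sym ac ad
    by (simp add: edge_count_insert_left edge_count_insert_right edge_count_singletons)
  ultimately have "card (cut V E ?K) \<le> 3"
    using card_cut_plus_inside[OF KV] cardK edge_count_commute[of E "{u, c, d}" "{a, v}"]
    by linarith
  then have "card ?K \<le> 1 \<or> card (V - ?K) \<le> 1" by (rule small_cut[OF KV])
  moreover have "card (V - ?K) = card V - 5" using KV cardK by (simp add: card_Diff_subset)
  ultimately show False using cardK assms(1) by simp
qed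

text \<open>A set and its complement have the same cut, so the side containing \<open>u\<close> may
  be taken. \<open>differs_as_cut_side\<close> keeps either choice different from
  \<open>{u, v}\<close>.\<close>

lemma cut_side_oriented:
  assumes "S \<subseteq> V" and "differs_as_cut_side V S {u, v}" and "card (cut V E S) = 4"
    and "{a, u} \<in> cut V E S" and "{v, w} \<in> cut V E S"
  obtains S' where "S' \<subseteq> V" "S' \<noteq> {u, v}" "card (cut V E S') = 4" "u \<in> S'" "a \<notin> S'"
    "v \<in> S' \<longleftrightarrow> w \<notin> S'"
proof (cases "u \<in> S")
  case True
  have "a \<notin> S" using assms True by (auto simp: cut_def doubleton_eq_iff)
  moreover have "v \<in> S \<longleftrightarrow> w \<notin> S" using assms by (auto simp: cut_def doubleton_eq_iff)
  ultimately show ?thesis using that[of S] True assms by (auto simp: differs_as_cut_side_def)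
next
  case False
  have "a \<in> S" "u \<in> V" using assms False by (auto simp: cut_def doubleton_eq_iff)
  moreover have "v \<in> V - S \<longleftrightarrow> w \<notin> V - S" using assms by (auto simp: cut_def doubleton_eq_iff)
  ultimately show ?thesis
    using that[of "V - S"] False assms by (auto simp: differs_as_cut_side_def cut_complement)
qed

end

theorem lemma1:
  fixes V :: "'a set" and E :: "'a set set" and a u v c d :: 'a
  assumes "simple_graph V E"
    and "cubic V E"
    and "essentially_edge_connected 4 V E"
    and "card V > 6"
    and "{a, u} \<in> E" and "{u, v} \<in> E" and "{v, c} \<in> E" and "{v, d} \<in> E"
    and "distinct [{a, u}, {u, v}, {v, c}, {v, d}]"
  shows "\<not> (\<exists>S S'. S \<subseteq> V \<and> S' \<subseteq> V \<and>
             differs_as_cut_side V S {u, v} \<and> differs_as_cut_side V S' {u, v} \<and>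
             {a, u} \<in> cut V E S \<and> {v, d} \<in> cut V E S \<and>
             {a, u} \<in> cut V E S' \<and> {v, c} \<in> cut V E S' \<and>
             card (cut V E S) = 4 \<and> card (cut V E S') = 4)"
proof -
  interpret essentially_4_connected_cubic V E
    using assms(1-3) by unfold_locales
  \<comment> \<open>Each vertex equality would identify two of the four edges.\<close>
  have ne: "a \<noteq> v" "c \<noteq> d" "u \<noteq> c" "u \<noteq> d"
    using assms(9) by (auto simp: insert_commute)
  show ?thesis
  proof
    assume "\<exists>S S'. S \<subseteq> V \<and> S' \<subseteq> V \<and>
             differs_as_cut_side V S {u, v} \<and> differs_as_cut_side V S' {u, v} \<and>
             {a, u} \<in> cut V E S \<and> {v, d} \<in> cut V E S \<and>
             {a, u} \<in> cut V E S' \<and> {v, c} \<in> cut V E S' \<and>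
             card (cut V E S) = 4 \<and> card (cut V E S') = 4"
    then obtain S S' where *: "S \<subseteq> V" "S' \<subseteq> V"
      "differs_as_cut_side V S {u, v}" "differs_as_cut_side V S' {u, v}"
      "{a, u} \<in> cut V E S" "{v, d} \<in> cut V E S" "{a, u} \<in> cut V E S'" "{v, c} \<in> cut V E S'"
      "card (cut V E S) = 4" "card (cut V E S') = 4"
      by blast
    obtain P where P: "P \<subseteq> V" "P \<noteq> {u, v}" "card (cut V E P) = 4" "u \<in> P" "a \<notin> P"
        "v \<in> P \<longleftrightarrow> d \<notin> P"
      using cut_side_oriented[OF *(1,3,9,5,6)] .
    obtain Q where Q: "Q \<subseteq> V" "Q \<noteq> {u, v}" "card (cut V E Q) = 4" "u \<in> Q" "a \<notin> Q"
        "v \<in> Q \<longleftrightarrow> c \<notin> Q"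
      using cut_side_oriented[OF *(2,4,10,7,8)] .
    show False using no_two_cuts[OF assms(4-8) ne P Q] .
  qed
qed

end
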